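(* Let $n_1,n_2\ge 2$ be integers. The number of acyclic orientations of the complete tripartite graph $K_{n_1-1,n_2-1,1}$ is $$a(K_{n_1-1,n_2-1,1})=\frac{X}{2},$$ where $$X=1+\sum_{i=2}^{\min\{n_1,n_2\}+1}\bigl((i-2)!\bigr)^2\Bigl[(2i-3)S(n_1+1,i)S(n_2+1,i)-(i-2)\bigl(S(n_1+1,i)S(n_2,i)+S(n_1,i)S(n_2+1,i)\bigr)-S(n_1,i)S(n_2,i)\Bigr].$$
   Context: An acyclic orientation of a graph $G$ is an assignment of a direction to each edge of $G$ such that the resulting directed graph has no directed cycles; $a(G)$ denotes the number of acyclic orientations of $G$. $K_{p,q,r}$ is the complete tripartite graph with parts of sizes $p,q,r$: all edges between different parts and none within a part. $S(n,k)$ is the Stirling number of the second kind, the number of partitions of an $n$-element set into $k$ non-empty subsets; $S(n,k)=0$ for $k\ge n+1$. *)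

theory Defs
  imports Complex_Main "HOL-Combinatorics.Stirling"
begin

text \<open>
  A finite simple graph is a pair of a vertex set and a set of two-element subsets of it (its edges).
\<close>

type_synonym 'a graph = "'a set \<times> 'a set set"

definition verts :: "'a graph \<Rightarrow> 'a set" where
  "verts G = fst G"

definition edges :: "'a graph \<Rightarrow> 'a set set" where
  "edges G = snd G"

definition simple_graph :: "'a graph \<Rightarrow> bool" where
  "simple_graph G \<longleftrightarrow> finite (verts G) \<and> (\<forall>e\<in>edges G. e \<subseteq> verts G \<and> card e = 2)"

text \<open>
  An orientation is represented by its set of arcs: every arc lies on an edge, and every edge
  carries exactly one of its two possible arcs.
\<close>

definition orientation :: "'a graph \<Rightarrow> ('a \<times> 'a) set \<Rightarrow> bool" where
  "orientation G D \<longleftrightarrow>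
     (\<forall>(u, v)\<in>D. {u, v} \<in> edges G) \<and>
     (\<forall>e\<in>edges G. \<exists>!a. a \<in> D \<and> {fst a, snd a} = e)"

definition acyclic_orientations :: "'a graph \<Rightarrow> ('a \<times> 'a) set set" where
  "acyclic_orientations G = {D. orientation G D \<and> acyclic D}"

definition num_acyclic_orientations :: "'a graph \<Rightarrow> nat" where
  "num_acyclic_orientations G = card (acyclic_orientations G)"

text \<open>
  The first component of a vertex of the complete tripartite graph names its part.
\<close>

definition complete_tripartite :: "nat \<Rightarrow> nat \<Rightarrow> nat \<Rightarrow> (nat \<times> nat) graph" where
  "complete_tripartite p q r =
     (let V = {0} \<times> {..<p} \<union> {1} \<times> {..<q} \<union> {2} \<times> {..<r}
      in (V, {{u, v} | u v. u \<in> V \<and> v \<in> V \<and> fst u \<noteq> fst v}))"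

lemma simple_graph_complete_tripartite: "simple_graph (complete_tripartite p q r)"
proof -
  have "card {u, v} = 2" if "fst u \<noteq> fst v" for u v :: "nat \<times> nat"
    using that by (auto intro: card_2_iff[THEN iffD2])
  then show ?thesis
    by (fastforce simp: simple_graph_def complete_tripartite_def verts_def edges_def Let_def)
qed

text \<open>
  Because arcs are the only data of an orientation, there are finitely many orientations, so
  the cardinality in \<open>num_acyclic_orientations\<close> is never the default value for infinite sets.
\<close>

lemma finite_acyclic_orientations:
  assumes "simple_graph G"
  shows "finite (acyclic_orientations G)"
proof (rule finite_subset)
  show "acyclic_orientations G \<subseteq> Pow (verts G \<times> verts G)"
    using assms unfolding acyclic_orientations_def orientation_def simple_graph_def by fast
  show "finite (Pow (verts G \<times> verts G))"
    using assms by (simp add: simple_graph_def)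
qed

end

theory Submission
  imports Defs
begin

text \<open>
  An acyclic orientation of a nonempty graph has a source, so the signs \<open>(-1) ^ card S\<close> cancel
  when \<open>S\<close> runs over the subsets of its set of sources. Such a set \<open>S\<close> is independent, and the
  orientations having all of \<open>S\<close> as sources correspond to the acyclic orientations of \<open>G - S\<close>.
  Exchanging summations gives
  \<open>(\<Sum>S independent. (-1) ^ card S * a (G - S)) = 0\<close>
  (\<open>alternating_sum_acyclic_orientations\<close>), a recursion in which \<open>a G\<close> is the term \<open>S = {}\<close>.

  A nonempty independent set of a complete multipartite graph lies inside one part. Write \<open>\<nabla>\<close> for
  the signed sum over subsets of one part. For the complete bipartite graph on \<open>A\<close> and \<open>B\<close> the
  recursion says that \<open>b = a (K A B)\<close> satisfies \<open>\<nabla>\<^sub>A b + \<nabla>\<^sub>B b - b = 0\<close>, except that the value is \<open>1\<close> if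
  both parts are empty; adding a vertex adjacent to everything turns it into
  \<open>\<nabla>\<^sub>A f + \<nabla>\<^sub>B f - f = b\<close>. These equations determine \<open>b\<close> and \<open>f\<close> (\<open>source_defect_unique\<close>), so
  solutions only have to be exhibited.

  Put \<open>\<alpha>\<^sub>j p = j! S(p, j)\<close>, \<open>\<beta>\<^sub>j = \<alpha>\<^sub>j + \<alpha>\<^bsub>j+1\<^esub>\<close> and \<open>\<gamma>\<^sub>j = \<beta>\<^sub>j + \<beta>\<^bsub>j+1\<^esub>\<close> (\<open>surj_num\<close>, \<open>surj_num1\<close>,
  \<open>surj_num2\<close>). Then \<open>\<nabla>\<close> sends \<open>\<beta>\<close> to \<open>\<alpha>\<close> and \<open>\<gamma>\<close> to \<open>\<beta>\<close>. With primes for the second part,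
  \<open>\<alpha>\<^sub>j \<beta>\<^sub>j' + \<beta>\<^sub>j \<alpha>\<^sub>j' - \<beta>\<^sub>j \<beta>\<^sub>j' = \<alpha>\<^sub>j \<alpha>\<^sub>j' - \<alpha>\<^bsub>j+1\<^esub> \<alpha>\<^bsub>j+1\<^esub>'\<close>
  telescopes, so \<open>b = (\<Sum>j. \<beta>\<^sub>j \<beta>\<^sub>j')\<close>; the same identity one level up and summation by parts give
  \<open>f = (\<Sum>j. (j + 1) \<gamma>\<^sub>j \<gamma>\<^sub>j')\<close>.

  Finally, the Stirling recurrence shows that the summand of \<open>X\<close> with \<open>i = j + 2\<close> is
  \<open>2 (j + 1) \<gamma>\<^sub>j \<gamma>\<^sub>j'\<close> minus the telescoping term \<open>\<beta>\<^sub>j \<beta>\<^sub>j' - \<beta>\<^bsub>j+1\<^esub> \<beta>\<^bsub>j+1\<^esub>'\<close>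
  (\<open>summand_eq_telescoping\<close>). The latter sums to \<open>\<beta>\<^sub>0 \<beta>\<^sub>0' = 1\<close>, which the leading \<open>1\<close> of \<open>X\<close>
  compensates; hence \<open>X = 2 f\<close>.
\<close>

section \<open>Signed sums over subsets\<close>

text \<open>
  For \<open>h\<close> depending on the cardinality alone, this is the inverse binomial transform of \<open>h\<close>;
  in terms of exponential generating functions it is multiplication by \<open>exp (-x)\<close>.
\<close>

definition signed_sum :: "('a set \<Rightarrow> real) \<Rightarrow> 'a set \<Rightarrow> real" where
  "signed_sum h P = (\<Sum>S\<in>Pow P. (-1) ^ card S * h (P - S))"

lemma signed_sum_empty [simp]: "signed_sum h {} = h {}"
  by (simp add: signed_sum_def)

lemma signed_sum_insert:
  assumes "finite P" "x \<notin> P"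
  shows "signed_sum h (insert x P) = signed_sum (\<lambda>Q. h (insert x Q)) P - signed_sum h P"
proof -
  have "signed_sum h (insert x P) = (\<Sum>S\<in>Pow P. (-1) ^ card S * h (insert x P - S)) +
      (\<Sum>S\<in>insert x ` Pow P. (-1) ^ card S * h (insert x P - S))"
    unfolding signed_sum_def Pow_insert using assms by (intro sum.union_disjoint) auto
  also have "(\<Sum>S\<in>Pow P. (-1) ^ card S * h (insert x P - S)) = signed_sum (\<lambda>Q. h (insert x Q)) P"
    unfolding signed_sum_def using assms
    by (intro sum.cong) (auto intro!: arg_cong[where f = h])
  also have "(\<Sum>S\<in>insert x ` Pow P. (-1) ^ card S * h (insert x P - S)) =
      (\<Sum>S\<in>Pow P. (-1) ^ card (insert x S) * h (insert x P - insert x S))"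
    by (subst sum.reindex) (use assms in \<open>auto intro!: inj_onI\<close>)
  also have "\<dots> = (\<Sum>S\<in>Pow P. - ((-1) ^ card S * h (P - S)))"
  proof (intro sum.cong refl)
    fix S assume "S \<in> Pow P"
    then have "x \<notin> S" "finite S" using assms finite_subset by auto
    then show "(-1) ^ card (insert x S) * h (insert x P - insert x S) = - ((-1) ^ card S * h (P - S))"
      using assms by (simp add: insert_Diff_if)
  qed
  finally show ?thesis by (simp add: signed_sum_def sum_negf)
qed

lemma signed_sum_eq:
  assumes "finite P"
  shows "signed_sum h P = h P + (\<Sum>S\<in>Pow P - {{}}. (-1) ^ card S * h (P - S))"
  unfolding signed_sum_def using assms by (subst sum.remove[of _ "{}"]) auto

lemma signed_sum_cmult: "signed_sum (\<lambda>P. c * h P) P = c * signed_sum h P"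
  unfolding signed_sum_def sum_distrib_left by (simp add: mult.left_commute)

lemma signed_sum_sum: "signed_sum (\<lambda>P. \<Sum>j\<in>J. h j P) P = (\<Sum>j\<in>J. signed_sum (h j) P)"
  unfolding signed_sum_def sum_distrib_left by (rule sum.swap)

lemma signed_sum_add: "signed_sum (\<lambda>P. g P + h P) P = signed_sum g P + signed_sum h P"
  unfolding signed_sum_def by (simp add: sum.distrib distrib_left)

lemma sum_signs_Pow:
  fixes P :: "'a set"
  assumes "finite P" "P \<noteq> {}"
  shows "(\<Sum>S\<in>Pow P. (-1) ^ card S) = (0::real)"
proof -
  obtain x Q where "P = insert x Q" "x \<notin> Q" using assms(2) by (meson ex_in_conv mk_disjoint_insert)
  then have "signed_sum (\<lambda>_. 1) P = 0" using assms(1) by (simp add: signed_sum_insert)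
  then show ?thesis by (simp add: signed_sum_def)
qed

section \<open>Inclusion-exclusion over the sources of an acyclic orientation\<close>

definition independent :: "'a graph \<Rightarrow> 'a set \<Rightarrow> bool" where
  "independent G S \<longleftrightarrow> S \<subseteq> verts G \<and> (\<forall>e\<in>edges G. \<not> e \<subseteq> S)"

definition remove_verts :: "'a graph \<Rightarrow> 'a set \<Rightarrow> 'a graph" where
  "remove_verts G S = (verts G - S, {e \<in> edges G. e \<inter> S = {}})"

definition sources :: "'a graph \<Rightarrow> ('a \<times> 'a) set \<Rightarrow> 'a set" where
  "sources G D = {v \<in> verts G. \<forall>u. (u, v) \<notin> D}"

lemma simple_graph_edgeD:
  assumes "simple_graph G" "{u, v} \<in> edges G"
  shows "u \<noteq> v" "u \<in> verts G" "v \<in> verts G"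
  using assms unfolding simple_graph_def by fastforce+

lemma simple_graph_edgeE:
  assumes "simple_graph G" "e \<in> edges G"
  obtains u v where "e = {u, v}" "u \<noteq> v"
  using assms unfolding simple_graph_def by (metis card_2_iff)

lemma simple_graph_remove_verts: "simple_graph G \<Longrightarrow> simple_graph (remove_verts G S)"
  unfolding simple_graph_def remove_verts_def verts_def edges_def by auto

lemma orientation_iff:
  assumes G: "simple_graph G"
  shows "orientation G D \<longleftrightarrow> (\<forall>u v. (u, v) \<in> D \<longrightarrow> {u, v} \<in> edges G) \<and>
    (\<forall>u v. {u, v} \<in> edges G \<longrightarrow> ((u, v) \<in> D \<longleftrightarrow> (v, u) \<notin> D))"
proof -
  have unique_arc: "(\<exists>!a. a \<in> D \<and> {fst a, snd a} = {u, v}) \<longleftrightarrow> ((u, v) \<in> D \<longleftrightarrow> (v, u) \<notin> D)"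
    if "u \<noteq> v" for u v
  proof -
    have "a \<in> D \<and> {fst a, snd a} = {u, v} \<longleftrightarrow> (a = (u, v) \<or> a = (v, u)) \<and> a \<in> D" for a
      by (cases a) (auto simp: doubleton_eq_iff)
    then have "(\<exists>!a. a \<in> D \<and> {fst a, snd a} = {u, v}) \<longleftrightarrow> (\<exists>!a. (a = (u, v) \<or> a = (v, u)) \<and> a \<in> D)"
      by (simp only:)
    also have "\<dots> \<longleftrightarrow> ((u, v) \<in> D \<longleftrightarrow> (v, u) \<notin> D)"
      using that by (metis prod.inject)
    finally show ?thesis .
  qed
  have "(\<forall>e\<in>edges G. \<exists>!a. a \<in> D \<and> {fst a, snd a} = e) \<longleftrightarrow>
      (\<forall>u v. {u, v} \<in> edges G \<longrightarrow> ((u, v) \<in> D \<longleftrightarrow> (v, u) \<notin> D))" (is "?L \<longleftrightarrow> ?R")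
  proof
    assume L: ?L
    show ?R
    proof (intro allI impI)
      fix u v assume e: "{u, v} \<in> edges G"
      show "(u, v) \<in> D \<longleftrightarrow> (v, u) \<notin> D"
        using bspec[OF L e] unique_arc[OF simple_graph_edgeD(1)[OF G e]] by simp
    qed
  next
    assume R: ?R
    show ?L
    proof
      fix e assume e: "e \<in> edges G"
      then obtain u v where "e = {u, v}" "u \<noteq> v" using simple_graph_edgeE[OF G] by metis
      then show "\<exists>!a. a \<in> D \<and> {fst a, snd a} = e" using unique_arc[of u v] R e by simp
    qed
  qed
  then show ?thesis unfolding orientation_def by auto
qed

lemma acyclic_orientations_iff:
  assumes "simple_graph G"
  shows "D \<in> acyclic_orientations G \<longleftrightarrow> (\<forall>u v. (u, v) \<in> D \<longrightarrow> {u, v} \<in> edges G) \<and>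
    (\<forall>u v. {u, v} \<in> edges G \<longrightarrow> ((u, v) \<in> D \<longleftrightarrow> (v, u) \<notin> D)) \<and> acyclic D"
  by (simp add: acyclic_orientations_def orientation_iff[OF assms])

text \<open>
  A finite acyclic relation is well-founded, and a minimal vertex is a source.
\<close>

lemma sources_nonempty:
  assumes G: "simple_graph G" and D: "D \<in> acyclic_orientations G" and "verts G \<noteq> {}"
  shows "sources G D \<noteq> {}"
proof -
  have "{u, v} \<in> edges G" if "(u, v) \<in> D" for u v
    using that D by (simp add: acyclic_orientations_iff[OF G])
  then have "D \<subseteq> verts G \<times> verts G"
    using simple_graph_edgeD(2,3)[OF G] by (meson SigmaI subrelI)
  moreover have "finite (verts G)" using G by (simp add: simple_graph_def)
  ultimately have "wf D"
    using D finite_acyclic_wf[of D] finite_subset[of D "verts G \<times> verts G"]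
    by (simp add: acyclic_orientations_def)
  then obtain z where "z \<in> verts G" "\<And>y. (y, z) \<in> D \<Longrightarrow> y \<notin> verts G"
    using \<open>verts G \<noteq> {}\<close> by (meson ex_in_conv wfE_min)
  then have "z \<in> sources G D"
    using \<open>D \<subseteq> verts G \<times> verts G\<close> unfolding sources_def by blast
  then show ?thesis by blast
qed

lemma independent_subset_sources:
  assumes G: "simple_graph G" and D: "D \<in> acyclic_orientations G" and S: "S \<subseteq> sources G D"
  shows "independent G S"
proof -
  have "\<not> e \<subseteq> S" if e: "e \<in> edges G" for e
  proof
    assume "e \<subseteq> S"
    moreover obtain u v where "e = {u, v}" using simple_graph_edgeE[OF G e] by metis
    ultimately show False
      using e D S unfolding acyclic_orientations_def orientation_iff[OF G] sources_def by blast
  qed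
  then show ?thesis using S unfolding independent_def sources_def by blast
qed

text \<open>
  Deleting \<open>S\<close> loses no information when all vertices of \<open>S\<close> are sources, because then every edge at
  \<open>S\<close> is directed away from \<open>S\<close>. Conversely, directing all edges at \<open>S\<close> away from \<open>S\<close> is
  consistent because \<open>S\<close> is independent, and it creates no cycle because no arc enters \<open>S\<close>.
\<close>

lemma card_acyclic_orientations_sources:
  assumes G: "simple_graph G" and S: "independent G S"
  shows "card {D \<in> acyclic_orientations G. S \<subseteq> sources G D} =
    num_acyclic_orientations (remove_verts G S)"
proof -
  define adj where "adj u v \<longleftrightarrow> {u, v} \<in> edges G" for u v
  define restrict :: "('a \<times> 'a) set \<Rightarrow> ('a \<times> 'a) set"
    where "restrict D = {(u, v) \<in> D. u \<notin> S \<and> v \<notin> S}" for D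
  define star where "star = {(s, w). s \<in> S \<and> adj s w}"
  have adj_sym: "adj u v \<Longrightarrow> adj v u" for u v
    by (simp add: adj_def insert_commute)
  have indep: "v \<notin> S" if "adj u v" "u \<in> S" for u v
  proof -
    have "\<not> {u, v} \<subseteq> S" using S that(1) unfolding independent_def adj_def by (elim conjE bspec)
    then show ?thesis using that(2) by simp
  qed
  have "{u, v} \<in> edges (remove_verts G S) \<longleftrightarrow> adj u v \<and> u \<notin> S \<and> v \<notin> S" for u v
    unfolding remove_verts_def adj_def by (auto simp: edges_def)
  then have AO': "D \<in> acyclic_orientations (remove_verts G S) \<longleftrightarrow>
      (\<forall>u v. (u, v) \<in> D \<longrightarrow> adj u v \<and> u \<notin> S \<and> v \<notin> S) \<and>
      (\<forall>u v. adj u v \<and> u \<notin> S \<and> v \<notin> S \<longrightarrow> ((u, v) \<in> D \<longleftrightarrow> (v, u) \<notin> D)) \<and> acyclic D" for D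
    by (simp add: acyclic_orientations_iff[OF simple_graph_remove_verts[OF G]])
  have AO: "D \<in> acyclic_orientations G \<longleftrightarrow> (\<forall>u v. (u, v) \<in> D \<longrightarrow> adj u v) \<and>
      (\<forall>u v. adj u v \<longrightarrow> ((u, v) \<in> D \<longleftrightarrow> (v, u) \<notin> D)) \<and> acyclic D" for D
    by (simp add: acyclic_orientations_iff[OF G] adj_def)
  have sources: "S \<subseteq> sources G D \<longleftrightarrow> (\<forall>u v. (u, v) \<in> D \<longrightarrow> v \<notin> S)" for D
    using S unfolding independent_def sources_def by blast
  have restrict: "restrict D \<in> acyclic_orientations (remove_verts G S)"
    if D: "D \<in> acyclic_orientations G" for D
  proof -
    have "restrict D \<subseteq> D" unfolding restrict_def by blast
    then have "acyclic (restrict D)" using D acyclic_subset unfolding AO by blast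
    then show ?thesis using D unfolding AO AO' by (simp add: restrict_def)
  qed
  have extend: "D \<union> star \<in> acyclic_orientations G \<and> S \<subseteq> sources G (D \<union> star)"
    if D: "D \<in> acyclic_orientations (remove_verts G S)" for D
  proof -
    have avoid: "adj u v \<and> u \<notin> S \<and> v \<notin> S" if "(u, v) \<in> D" for u v
      using that D unfolding AO' by blast
    have total: "(u, v) \<in> D \<longleftrightarrow> (v, u) \<notin> D" if "adj u v" "u \<notin> S" "v \<notin> S" for u v
      using that D unfolding AO' by blast
    have star: "(u, v) \<in> star \<longleftrightarrow> u \<in> S \<and> adj u v" for u v
      by (simp add: star_def)
    \<comment> \<open>A walk cannot enter \<open>S\<close>, so a cycle would avoid \<open>S\<close> and lie in \<open>D\<close>.\<close>
    have "y \<notin> S \<and> (x \<notin> S \<longrightarrow> (x, y) \<in> D\<^sup>+)" if "(x, y) \<in> (D \<union> star)\<^sup>+" for x y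
      using that
    proof induction
      case (base y)
      then show ?case using avoid[of x y] indep[of x y] star[of x y] by auto
    next
      case (step y z)
      then have "(y, z) \<in> D" using star[of y z] by blast
      then show ?case using step.IH avoid[of y z] by (auto intro: trancl_into_trancl)
    qed
    moreover have "acyclic D" using D unfolding AO' by blast
    ultimately have "acyclic (D \<union> star)" unfolding acyclic_def by blast
    moreover have "(u, v) \<in> D \<union> star \<longrightarrow> adj u v" for u v
      using avoid[of u v] star[of u v] by blast
    moreover have "adj u v \<longrightarrow> ((u, v) \<in> D \<union> star \<longleftrightarrow> (v, u) \<notin> D \<union> star)" for u v
      using adj_sym[of u v] avoid[of u v] avoid[of v u] total[of u v] indep[of u v]
        star[of u v] star[of v u] by blast
    moreover have "(u, v) \<in> D \<union> star \<longrightarrow> v \<notin> S" for u v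
      using avoid[of u v] star[of u v] indep[of u v] by blast
    ultimately show ?thesis unfolding AO sources by blast
  qed
  have extend_restrict: "restrict D \<union> star = D"
    if D: "D \<in> acyclic_orientations G" "S \<subseteq> sources G D" for D
  proof -
    have arc: "adj u v \<and> v \<notin> S" if "(u, v) \<in> D" for u v
      using that D unfolding AO sources by blast
    have out: "(u, v) \<in> D" if "adj u v" "u \<in> S" for u v
      using that D unfolding AO sources by blast
    have "(u, v) \<in> restrict D \<union> star \<longleftrightarrow> (u, v) \<in> D" for u v
      using arc[of u v] out[of u v] by (auto simp: restrict_def star_def)
    then show ?thesis by auto
  qed
  have restrict_extend: "restrict (D \<union> star) = D"
    if D: "D \<in> acyclic_orientations (remove_verts G S)" for D
  proof -
    have "(u, v) \<in> D \<Longrightarrow> u \<notin> S \<and> v \<notin> S" for u v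
      using D unfolding AO' by blast
    then show ?thesis by (auto simp: restrict_def star_def)
  qed
  have "bij_betw restrict {D \<in> acyclic_orientations G. S \<subseteq> sources G D}
      (acyclic_orientations (remove_verts G S))"
    by (rule bij_betw_byWitness[where f' = "\<lambda>D. D \<union> star"])
      (use restrict extend extend_restrict restrict_extend in auto)
  then show ?thesis unfolding num_acyclic_orientations_def by (rule bij_betw_same_card)
qed

text \<open>
  Count pairs of an acyclic orientation \<open>D\<close> and a subset \<open>S\<close> of its sources, with sign
  \<open>(-1) ^ card S\<close>. For fixed \<open>D\<close> the signs cancel, as \<open>D\<close> has a source; for fixed \<open>S\<close> the number of
  \<open>D\<close> is that of the graph without \<open>S\<close>.
\<close>

theorem alternating_sum_acyclic_orientations:
  assumes G: "simple_graph G" and "verts G \<noteq> {}"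
  shows "(\<Sum>S | independent G S.
    (-1) ^ card S * real (num_acyclic_orientations (remove_verts G S))) = 0"
proof -
  define AO where "AO = acyclic_orientations G"
  have fin: "finite (verts G)" using G by (simp add: simple_graph_def)
  have finAO: "finite AO" unfolding AO_def by (rule finite_acyclic_orientations[OF G])
  have finI: "finite {S. independent G S}"
    by (rule finite_subset[of _ "Pow (verts G)"]) (auto simp: independent_def fin)
  have "(\<Sum>S | independent G S. (-1) ^ card S * real (num_acyclic_orientations (remove_verts G S))) =
      (\<Sum>S | independent G S. \<Sum>D\<in>{D\<in>AO. S \<subseteq> sources G D}. (-1) ^ card S)"
    by (intro sum.cong) (auto simp: AO_def card_acyclic_orientations_sources[OF G] mult.commute)
  also have "\<dots> = (\<Sum>D\<in>AO. \<Sum>S\<in>{S \<in> {S. independent G S}. S \<subseteq> sources G D}. (-1) ^ card S)"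
    by (rule sum.swap_restrict[OF finI finAO])
  also have "\<dots> = (\<Sum>D\<in>AO. \<Sum>S\<in>Pow (sources G D). (-1) ^ card S)"
    by (intro sum.cong) (use independent_subset_sources[OF G] in \<open>auto simp: AO_def\<close>)
  also have "\<dots> = 0"
  proof (rule sum.neutral, intro ballI, rule sum_signs_Pow)
    fix D assume "D \<in> AO"
    show "finite (sources G D)" using fin unfolding sources_def by simp
    show "sources G D \<noteq> {}"
      using \<open>D \<in> AO\<close> sources_nonempty[OF G] assms(2) unfolding AO_def by blast
  qed
  finally show ?thesis .
qed

section \<open>Functions of two sets determined by their source defect\<close>

text \<open>
  If \<open>f A B\<close> counts the acyclic orientations of a graph built on two disjoint parts \<open>A\<close> and \<open>B\<close>,
  this is the signed sum of \<open>f\<close> over the removal of all independent sets inside \<open>A\<close> or inside \<open>B\<close>;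
  the empty set would be counted twice, hence the subtraction.
\<close>

definition source_defect :: "('a set \<Rightarrow> 'a set \<Rightarrow> real) \<Rightarrow> 'a set \<Rightarrow> 'a set \<Rightarrow> real" where
  "source_defect f A B = signed_sum (\<lambda>A'. f A' B) A + signed_sum (\<lambda>B'. f A B') B - f A B"

text \<open>
  The coefficient of \<open>f A B\<close> in its own source defect is \<open>1 + 1 - 1 = 1\<close>, and all other terms involve
  smaller sets, so the defect is a recursion for \<open>f\<close>.
\<close>

lemma source_defect_unique:
  assumes "finite A" "finite B"
    and "\<And>A' B'. A' \<subseteq> A \<Longrightarrow> B' \<subseteq> B \<Longrightarrow> source_defect f A' B' = source_defect g A' B'"
  shows "f A B = g A B"
  using assms
proof (induction "card A + card B" arbitrary: A B rule: less_induct)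
  case less
  have left: "f (A - S) B = g (A - S) B" if "S \<in> Pow A - {{}}" for S
  proof (rule less.hyps)
    have "card (A - S) < card A"
      using that less.prems(1) by (intro psubset_card_mono) auto
    then show "card (A - S) + card B < card A + card B" by simp
    show "source_defect f A' B' = source_defect g A' B'" if "A' \<subseteq> A - S" "B' \<subseteq> B" for A' B'
      using that by (intro less.prems(3)) auto
  qed (use less.prems in auto)
  have right: "f A (B - S) = g A (B - S)" if "S \<in> Pow B - {{}}" for S
  proof (rule less.hyps)
    have "card (B - S) < card B"
      using that less.prems(2) by (intro psubset_card_mono) auto
    then show "card A + card (B - S) < card A + card B" by simp
    show "source_defect f A' B' = source_defect g A' B'" if "A' \<subseteq> A" "B' \<subseteq> B - S" for A' B'
      using that by (intro less.prems(3)) auto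
  qed (use less.prems in auto)
  have "source_defect f A B = source_defect g A B" by (rule less.prems(3)) auto
  then show ?case
    unfolding source_defect_def signed_sum_eq[OF less.prems(1)] signed_sum_eq[OF less.prems(2)]
    using left right by simp
qed

section \<open>Complete multipartite graphs\<close>

text \<open>
  Working with arbitrary vertex sets, whose parts are read off from first components, makes the
  family of complete multipartite graphs closed under deletion of vertices on the nose, so that no
  graph isomorphisms are needed.
\<close>

definition multipartite :: "('c \<times> 'b) set \<Rightarrow> ('c \<times> 'b) graph" where
  "multipartite V = (V, {{u, v} | u v. u \<in> V \<and> v \<in> V \<and> fst u \<noteq> fst v})"

abbreviation ao :: "('c \<times> 'b) set \<Rightarrow> real" where
  "ao V \<equiv> real (num_acyclic_orientations (multipartite V))"

lemma simple_graph_multipartite: "finite V \<Longrightarrow> simple_graph (multipartite V)"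
proof -
  have "card {u, v} = 2" if "fst u \<noteq> fst v" for u v :: "'c \<times> 'b"
    using that by (auto intro: card_2_iff[THEN iffD2])
  then show "finite V \<Longrightarrow> simple_graph (multipartite V)"
    by (fastforce simp: simple_graph_def multipartite_def verts_def edges_def)
qed

lemma verts_multipartite: "verts (multipartite V) = V"
  by (simp add: verts_def multipartite_def)

lemma remove_verts_multipartite: "remove_verts (multipartite V) S = multipartite (V - S)"
proof -
  have "{e \<in> {{u, v} | u v. u \<in> V \<and> v \<in> V \<and> fst u \<noteq> fst v}. e \<inter> S = {}} =
      {{u, v} | u v. u \<in> V - S \<and> v \<in> V - S \<and> fst u \<noteq> fst v}"
    by blast
  then show ?thesis by (simp add: remove_verts_def multipartite_def verts_def edges_def)
qed

lemma independent_multipartite: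
  "independent (multipartite V) S \<longleftrightarrow> S \<subseteq> V \<and> (\<forall>u\<in>S. \<forall>v\<in>S. fst u = fst v)"
proof -
  have ball: "(\<forall>e\<in>{f u v | u v. P u v}. Q e) \<longleftrightarrow> (\<forall>u v. P u v \<longrightarrow> Q (f u v))"
    for f :: "'x \<Rightarrow> 'x \<Rightarrow> 'y" and P Q by blast
  show ?thesis
    unfolding independent_def multipartite_def verts_def edges_def fst_conv snd_conv ball
      insert_subset by blast
qed

lemma ao_empty: "ao ({} :: ('c \<times> 'b) set) = 1"
proof -
  have "acyclic_orientations (multipartite ({} :: ('c \<times> 'b) set)) = {{}}"
    unfolding acyclic_orientations_def orientation_def multipartite_def edges_def
    by (auto simp: acyclic_def)
  then show ?thesis by (simp add: num_acyclic_orientations_def)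
qed

text \<open>
  The empty set is removed from one of the two power sets to make the union disjoint.
\<close>

lemma independent_bipartite:
  assumes "A \<subseteq> {a} \<times> UNIV" "B \<subseteq> {b} \<times> UNIV" "a \<noteq> b"
  shows "{S. independent (multipartite (A \<union> B)) S} = (Pow A - {{}}) \<union> Pow B"
proof -
  have fsts: "\<And>u. u \<in> A \<Longrightarrow> fst u = a" "\<And>u. u \<in> B \<Longrightarrow> fst u = b" using assms(1,2) by auto
  have "S \<subseteq> A \<union> B \<and> (\<forall>u\<in>S. \<forall>v\<in>S. fst u = fst v) \<longleftrightarrow> S \<subseteq> A \<or> S \<subseteq> B" for S
  proof
    assume S: "S \<subseteq> A \<union> B \<and> (\<forall>u\<in>S. \<forall>v\<in>S. fst u = fst v)"
    show "S \<subseteq> A \<or> S \<subseteq> B"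
    proof (rule ccontr)
      assume "\<not> (S \<subseteq> A \<or> S \<subseteq> B)"
      then obtain u v where uv: "u \<in> S" "u \<notin> A" "v \<in> S" "v \<notin> B" by blast
      then have "u \<in> B" "v \<in> A" using S by blast+
      moreover have "fst u = fst v" using S uv by blast
      ultimately show False using fsts[of u] fsts[of v] assms(3) by simp
    qed
  next
    assume "S \<subseteq> A \<or> S \<subseteq> B"
    then show "S \<subseteq> A \<union> B \<and> (\<forall>u\<in>S. \<forall>v\<in>S. fst u = fst v)"
      using fsts by (metis UnCI subset_iff)
  qed
  then show ?thesis unfolding independent_multipartite by auto
qed

lemma independent_cone:
  assumes "A \<subseteq> {a} \<times> UNIV" "B \<subseteq> {b} \<times> UNIV" "a \<noteq> b" "fst x \<noteq> a" "fst x \<noteq> b"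
  shows "{S. independent (multipartite (insert x (A \<union> B))) S} = insert {x} ((Pow A - {{}}) \<union> Pow B)"
proof -
  have apex: "fst u \<noteq> fst x" if "u \<in> A \<union> B" for u using that assms by auto
  have "independent (multipartite (insert x (A \<union> B))) S \<longleftrightarrow>
      S = {x} \<or> independent (multipartite (A \<union> B)) S" for S
  proof (cases "x \<in> S")
    case True
    have "S = {x}" if "S \<subseteq> insert x (A \<union> B)" "\<forall>u\<in>S. \<forall>v\<in>S. fst u = fst v"
    proof -
      have "u = x" if "u \<in> S" for u
        using that True \<open>S \<subseteq> _\<close> \<open>\<forall>u\<in>S. _ u\<close> apex[of u] by blast
      then show ?thesis using True by blast
    qed
    moreover have "\<not> S \<subseteq> A \<union> B" using True apex[of x] by blast
    ultimately show ?thesis unfolding independent_multipartite by blast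
  next
    case False
    then show ?thesis unfolding independent_multipartite subset_insert[OF False] by blast
  qed
  then show ?thesis using independent_bipartite[OF assms(1-3)] by auto
qed

text \<open>
  This is \<open>alternating_sum_acyclic_orientations\<close> with the independent sets sorted by part.
\<close>

lemma bipartite_source_defect:
  assumes fin: "finite A" "finite B"
    and part: "A \<subseteq> {a} \<times> UNIV" "B \<subseteq> {b} \<times> UNIV" "a \<noteq> b" and ne: "A \<union> B \<noteq> {}"
  shows "source_defect (\<lambda>A B. ao (A \<union> B)) A B = 0"
proof -
  let ?h = "\<lambda>S. (-1) ^ card S * ao (A \<union> B - S)"
  have disj: "A \<inter> B = {}" using part by auto
  have "sum ?h (Pow A - {{}} \<union> Pow B) = 0"
    using alternating_sum_acyclic_orientations[OF simple_graph_multipartite, of "A \<union> B"] fin ne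
    by (simp add: remove_verts_multipartite independent_bipartite[OF part] verts_multipartite)
  moreover have "sum ?h (Pow A - {{}} \<union> Pow B) = sum ?h (Pow A - {{}}) + sum ?h (Pow B)"
    using fin disj by (intro sum.union_disjoint) auto
  moreover have "A \<union> B - S = (A - S) \<union> B" if "S \<subseteq> A" for S
    using disj that by blast
  then have "sum ?h (Pow A - {{}}) = signed_sum (\<lambda>A. ao (A \<union> B)) A - ao (A \<union> B)"
    unfolding signed_sum_eq[OF fin(1)] by simp
  moreover have "A \<union> B - S = A \<union> (B - S)" if "S \<subseteq> B" for S
    using disj that by blast
  then have "sum ?h (Pow B) = signed_sum (\<lambda>B. ao (A \<union> B)) B"
    unfolding signed_sum_def by simp
  ultimately show ?thesis unfolding source_defect_def by simp
qed

text \<open>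
  The apex \<open>x\<close> contributes one further independent set \<open>{x}\<close>, with sign \<open>-1\<close>, whose removal leaves
  the bipartite graph.
\<close>

lemma cone_source_defect:
  assumes fin: "finite A" "finite B"
    and part: "A \<subseteq> {a} \<times> UNIV" "B \<subseteq> {b} \<times> UNIV" "a \<noteq> b" "fst x \<noteq> a" "fst x \<noteq> b"
  shows "source_defect (\<lambda>A B. ao (insert x (A \<union> B))) A B = ao (A \<union> B)"
proof -
  let ?V = "insert x (A \<union> B)"
  let ?h = "\<lambda>S. (-1) ^ card S * ao (?V - S)"
  have disj: "A \<inter> B = {}" "x \<notin> A" "x \<notin> B" using part by auto
  have "sum ?h (insert {x} (Pow A - {{}} \<union> Pow B)) = 0"
    using alternating_sum_acyclic_orientations[OF simple_graph_multipartite, of ?V] fin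
    unfolding remove_verts_multipartite independent_cone[OF part] verts_multipartite by blast
  moreover have "sum ?h (insert {x} (Pow A - {{}} \<union> Pow B)) =
      ?h {x} + sum ?h (Pow A - {{}} \<union> Pow B)"
    using fin disj by (intro sum.insert) auto
  moreover have "sum ?h (Pow A - {{}} \<union> Pow B) = sum ?h (Pow A - {{}}) + sum ?h (Pow B)"
    using fin disj by (intro sum.union_disjoint) auto
  moreover have "insert x (A \<union> B) - S = insert x ((A - S) \<union> B)" if "S \<subseteq> A" for S
    using disj that by blast
  then have "sum ?h (Pow A - {{}}) = signed_sum (\<lambda>A. ao (insert x (A \<union> B))) A - ao ?V"
    unfolding signed_sum_eq[OF fin(1)] by simp
  moreover have "insert x (A \<union> B) - S = insert x (A \<union> (B - S))" if "S \<subseteq> B" for S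
    using disj that by blast
  then have "sum ?h (Pow B) = signed_sum (\<lambda>B. ao (insert x (A \<union> B))) B"
    unfolding signed_sum_def by simp
  moreover have "?h {x} = - ao (A \<union> B)" using disj by (simp add: insert_Diff_if)
  ultimately show ?thesis unfolding source_defect_def by simp
qed

section \<open>Surjection numbers\<close>

text \<open>
  The number of surjections from a \<open>p\<close>-set onto a \<open>j\<close>-set. The two variants after it count the maps
  into a set with one, respectively two, more elements that hit \<open>j\<close> prescribed elements: each
  optional element is either hit or not.
\<close>

definition surj_num :: "nat \<Rightarrow> nat \<Rightarrow> real" where
  "surj_num j p = fact j * real (Stirling p j)"

definition surj_num1 :: "nat \<Rightarrow> nat \<Rightarrow> real" where
  "surj_num1 j p = surj_num j p + surj_num (Suc j) p"

definition surj_num2 :: "nat \<Rightarrow> nat \<Rightarrow> real" where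
  "surj_num2 j p = surj_num1 j p + surj_num1 (Suc j) p"

lemma surj_num1_eq: "surj_num1 j p = fact j * real (Stirling (Suc p) (Suc j))"
  by (simp add: surj_num1_def surj_num_def algebra_simps)

lemma surj_num1_Suc:
  "surj_num1 j (Suc p) = real (Suc j) * surj_num1 j p + real j * surj_num1 (j - 1) p"
  by (cases j) (simp_all add: surj_num1_eq algebra_simps)

text \<open>
  A map counted by \<open>surj_num1\<close> is a subset of \<open>P\<close>, the preimage of the optional element, together
  with a surjection defined on its complement. So \<open>surj_num1\<close> is the unsigned subset sum of
  \<open>surj_num\<close>, and the signed sum inverts it. The proof is an induction on \<open>P\<close> that matches the
  Pascal-type rule \<open>signed_sum_insert\<close> with the Stirling recurrence.
\<close>

lemma signed_sum_surj_num1: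
  "finite P \<Longrightarrow> signed_sum (\<lambda>Q. surj_num1 j (card Q)) P = surj_num j (card P)"
proof (induction P arbitrary: j rule: finite_induct)
  case empty
  show ?case by (cases j) (simp_all add: surj_num1_def surj_num_def)
next
  case (insert x P)
  have "signed_sum (\<lambda>Q. surj_num1 j (card (insert x Q))) P =
      signed_sum (\<lambda>Q. real (Suc j) * surj_num1 j (card Q) + real j * surj_num1 (j - 1) (card Q)) P"
    unfolding signed_sum_def
  proof (intro sum.cong refl)
    fix S assume "S \<in> Pow P"
    have "card (insert x (P - S)) = Suc (card (P - S))" using insert.hyps by simp
    then show "(-1) ^ card S * surj_num1 j (card (insert x (P - S))) =
      (-1) ^ card S * (real (Suc j) * surj_num1 j (card (P - S)) + real j * surj_num1 (j - 1) (card (P - S)))"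
      by (simp only: surj_num1_Suc)
  qed
  also have "\<dots> = real (Suc j) * surj_num j (card P) + real j * surj_num (j - 1) (card P)"
    by (simp only: signed_sum_add signed_sum_cmult insert.IH)
  finally have "signed_sum (\<lambda>Q. surj_num1 j (card Q)) (insert x P) =
      real j * (surj_num j (card P) + surj_num (j - 1) (card P))"
    by (simp add: signed_sum_insert insert.hyps insert.IH algebra_simps)
  also have "\<dots> = surj_num j (Suc (card P))"
    by (cases j) (simp_all add: surj_num_def algebra_simps)
  finally show ?case using insert.hyps by simp
qed

lemma signed_sum_surj_num2:
  "finite P \<Longrightarrow> signed_sum (\<lambda>Q. surj_num2 j (card Q)) P = surj_num1 j (card P)"
  by (simp only: surj_num2_def signed_sum_add signed_sum_surj_num1) (simp only: surj_num1_def)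

lemma surj_num1_gt: "p < j \<Longrightarrow> surj_num1 j p = 0"
  by (simp add: surj_num1_eq)

lemma source_defect_sum:
  "source_defect (\<lambda>A B. \<Sum>j\<in>J. c j * (g j A * h j B)) A B =
    (\<Sum>j\<in>J. c j * (signed_sum (g j) A * h j B + g j A * signed_sum (h j) B - g j A * h j B))"
proof -
  have "signed_sum (\<lambda>A'. c j * (g j A' * h j B)) A = c j * (signed_sum (g j) A * h j B)" for j
    using signed_sum_cmult[of "c j * h j B" "g j" A] by (simp add: mult_ac)
  moreover have "signed_sum (\<lambda>B'. c j * (g j A * h j B')) B = c j * (g j A * signed_sum (h j) B)" for j
    using signed_sum_cmult[of "c j * g j A" "h j" B] by (simp add: mult_ac)
  ultimately show ?thesis
    by (simp add: source_defect_def signed_sum_sum sum.distrib sum_subtractf algebra_simps)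
qed

section \<open>Counting acyclic orientations\<close>

text \<open>
  These are the poly-Bernoulli numbers of negative index. The upper limit \<open>N\<close> is a free parameter,
  because the induction behind \<open>source_defect_unique\<close> compares the two sides on all subsets of \<open>A\<close>
  and \<open>B\<close> for one fixed range of summation.
\<close>

theorem ao_bipartite:
  assumes fin: "finite A" "finite B"
    and part: "A \<subseteq> {a} \<times> UNIV" "B \<subseteq> {b} \<times> UNIV" "a \<noteq> b"
    and N: "min (card A) (card B) \<le> N"
  shows "ao (A \<union> B) = (\<Sum>j\<le>N. surj_num1 j (card A) * surj_num1 j (card B))"
proof -
  define F where "F A B = (\<Sum>j\<le>N. 1 * (surj_num1 j (card A) * surj_num1 j (card B)))"
    for A B :: "('a \<times> 'b) set"
  have "ao (A \<union> B) = F A B"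
  proof (rule source_defect_unique[OF fin, where f = "\<lambda>A B. ao (A \<union> B)"])
    fix A' B' assume sub: "A' \<subseteq> A" "B' \<subseteq> B"
    then have fin': "finite A'" "finite B'" using fin finite_subset by blast+
    let ?p = "card A'" and ?q = "card B'"
    have "min ?p ?q \<le> N"
      using N card_mono[OF fin(1) sub(1)] card_mono[OF fin(2) sub(2)] by linarith
    \<comment> \<open>The boundary term of the telescoping sum vanishes, as \<open>S(p, j) = 0\<close> for \<open>j > p\<close>.\<close>
    then have top: "surj_num (Suc N) ?p * surj_num (Suc N) ?q = 0"
      by (auto simp: surj_num_def min_le_iff_disj)
    have "source_defect F A' B' = (\<Sum>j\<le>N. surj_num j ?p * surj_num1 j ?q
        + surj_num1 j ?p * surj_num j ?q - surj_num1 j ?p * surj_num1 j ?q)"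
      unfolding F_def source_defect_sum signed_sum_surj_num1[OF fin'(1)] signed_sum_surj_num1[OF fin'(2)]
      by simp
    also have "\<dots> = (\<Sum>j\<le>N. surj_num j ?p * surj_num j ?q
        - surj_num (Suc j) ?p * surj_num (Suc j) ?q)"
      by (intro sum.cong) (simp_all add: surj_num1_def algebra_simps)
    also have "\<dots> = surj_num 0 ?p * surj_num 0 ?q"
      using sum_telescope[of "\<lambda>j. surj_num j ?p * surj_num j ?q" N] top by simp
    finally have F: "source_defect F A' B' = surj_num 0 ?p * surj_num 0 ?q" .
    show "source_defect (\<lambda>A B. ao (A \<union> B)) A' B' = source_defect F A' B'"
    proof (cases "A' = {} \<and> B' = {}")
      case True
      then show ?thesis
        using F by (simp add: source_defect_def[of "\<lambda>A B. ao (A \<union> B)"] ao_empty surj_num_def)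
    next
      case False
      then have "?p \<noteq> 0 \<or> ?q \<noteq> 0" using fin' by simp
      then have "source_defect F A' B' = 0"
        unfolding F by (auto simp: surj_num_def gr0_conv_Suc)
      then show ?thesis
        using bipartite_source_defect[of A' B' a b] fin' sub part False by auto
    qed
  qed
  then show ?thesis by (simp add: F_def)
qed

text \<open>
  With \<open>x\<^sub>j\<close> the summand of \<open>ao_bipartite\<close>, the source defect of the right-hand side has the summand
  \<open>(j + 1) (x\<^sub>j - x\<^bsub>j+1\<^esub>) = x\<^sub>j + (j x\<^sub>j - (j + 1) x\<^bsub>j+1\<^esub>)\<close>. The bracket telescopes to zero, and what
  remains is the bipartite count, as required by \<open>cone_source_defect\<close>.
\<close>

theorem ao_cone:
  assumes fin: "finite A" "finite B"
    and part: "A \<subseteq> {a} \<times> UNIV" "B \<subseteq> {b} \<times> UNIV" "a \<noteq> b" "fst x \<noteq> a" "fst x \<noteq> b"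
    and N: "min (card A) (card B) \<le> N"
  shows "ao (insert x (A \<union> B)) = (\<Sum>j\<le>N. real (Suc j) * (surj_num2 j (card A) * surj_num2 j (card B)))"
proof -
  define F where "F A B = (\<Sum>j\<le>N. real (Suc j) * (surj_num2 j (card A) * surj_num2 j (card B)))"
    for A B :: "('a \<times> 'b) set"
  have "ao (insert x (A \<union> B)) = F A B"
  proof (rule source_defect_unique[OF fin, where f = "\<lambda>A B. ao (insert x (A \<union> B))"])
    fix A' B' assume sub: "A' \<subseteq> A" "B' \<subseteq> B"
    then have fin': "finite A'" "finite B'" using fin finite_subset by blast+
    let ?p = "card A'" and ?q = "card B'"
    have min: "min ?p ?q \<le> N"
      using N card_mono[OF fin(1) sub(1)] card_mono[OF fin(2) sub(2)] by linarith
    then have top: "surj_num1 (Suc N) ?p * surj_num1 (Suc N) ?q = 0"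
      by (auto simp: surj_num1_gt min_le_iff_disj)
    have "source_defect F A' B' = (\<Sum>j\<le>N. real (Suc j) * (surj_num1 j ?p * surj_num2 j ?q
        + surj_num2 j ?p * surj_num1 j ?q - surj_num2 j ?p * surj_num2 j ?q))"
      unfolding F_def source_defect_sum signed_sum_surj_num2[OF fin'(1)] signed_sum_surj_num2[OF fin'(2)] ..
    also have "\<dots> = (\<Sum>j\<le>N. surj_num1 j ?p * surj_num1 j ?q
        + (real j * (surj_num1 j ?p * surj_num1 j ?q)
          - real (Suc j) * (surj_num1 (Suc j) ?p * surj_num1 (Suc j) ?q)))"
      by (intro sum.cong) (simp_all add: surj_num2_def algebra_simps)
    also have "\<dots> = (\<Sum>j\<le>N. surj_num1 j ?p * surj_num1 j ?q)"
      using sum_telescope[of "\<lambda>j. real j * (surj_num1 j ?p * surj_num1 j ?q)" N] top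
      by (simp add: sum.distrib del: of_nat_Suc)
    also have "\<dots> = ao (A' \<union> B')"
      using ao_bipartite[of A' B' a b N] fin' sub part min by auto
    also have "\<dots> = source_defect (\<lambda>A B. ao (insert x (A \<union> B))) A' B'"
      using cone_source_defect[of A' B' a b x] fin' sub part by auto
    finally show "source_defect (\<lambda>A B. ao (insert x (A \<union> B))) A' B' = source_defect F A' B'" by simp
  qed
  then show ?thesis by (simp add: F_def)
qed

text \<open>
  With \<open>u = j! S(p+1, j+2)\<close> and \<open>a\<^sub>j = j! S(p+1, j+1)\<close> one has \<open>a\<^bsub>j+1\<^esub> = (j + 1) u\<close>, and the Stirling
  recurrence gives \<open>j! S(p+2, j+2) = (j + 2) u + a\<^sub>j\<close>; likewise for \<open>q\<close>. Both sides are then the same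
  polynomial in \<open>j\<close>, \<open>u\<close>, \<open>a\<^sub>j\<close> and their counterparts for \<open>q\<close>.
\<close>

lemma summand_eq_telescoping:
  fixes p q j :: nat
  defines "s \<equiv> \<lambda>n. real (Stirling n (j + 2))"
  defines "a \<equiv> \<lambda>j. surj_num1 j p" and "b \<equiv> \<lambda>j. surj_num1 j q"
  shows "(fact j)\<^sup>2 * ((2 * real (j + 2) - 3) * s (p + 2) * s (q + 2)
      - (real (j + 2) - 2) * (s (p + 2) * s (q + 1) + s (p + 1) * s (q + 2))
      - s (p + 1) * s (q + 1)) =
    2 * (real (Suc j) * (surj_num2 j p * surj_num2 j q)) - (a j * b j - a (Suc j) * b (Suc j))"
proof -
  define k where "k = real j"
  define u v where "u = fact j * s (p + 1)" and "v = fact j * s (q + 1)"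
  have a: "a (Suc j) = (k + 1) * u" "fact j * s (p + 2) = (k + 2) * u + a j"
    and b: "b (Suc j) = (k + 1) * v" "fact j * s (q + 2) = (k + 2) * v + b j"
    by (simp_all add: a_def b_def s_def u_def v_def k_def surj_num1_eq algebra_simps)
  have ab: "surj_num2 j p = a j + a (Suc j)" "surj_num2 j q = b j + b (Suc j)"
    by (simp_all add: surj_num2_def a_def b_def)
  have "(fact j)\<^sup>2 * ((2 * real (j + 2) - 3) * s (p + 2) * s (q + 2)
      - (real (j + 2) - 2) * (s (p + 2) * s (q + 1) + s (p + 1) * s (q + 2))
      - s (p + 1) * s (q + 1)) =
    (2 * k + 1) * (fact j * s (p + 2)) * (fact j * s (q + 2))
      - k * ((fact j * s (p + 2)) * v + u * (fact j * s (q + 2))) - u * v"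
    by (simp add: u_def v_def k_def power2_eq_square algebra_simps)
  also have "\<dots> = 2 * ((k + 1) * ((a j + a (Suc j)) * (b j + b (Suc j))))
      - (a j * b j - a (Suc j) * b (Suc j))"
    unfolding a b by algebra
  finally show ?thesis by (simp add: ab k_def algebra_simps)
qed

theorem theorem4p6:
  fixes n1 n2 :: nat
  assumes "n1 \<ge> 2" and "n2 \<ge> 2"
  shows "real (num_acyclic_orientations (complete_tripartite (n1 - 1) (n2 - 1) 1)) =
    (1 + (\<Sum>i = 2..min n1 n2 + 1. (fact (i - 2))\<^sup>2 *
       ((2 * real i - 3) * real (Stirling (n1 + 1) i) * real (Stirling (n2 + 1) i)
        - (real i - 2) * (real (Stirling (n1 + 1) i) * real (Stirling n2 i)
                          + real (Stirling n1 i) * real (Stirling (n2 + 1) i))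
        - real (Stirling n1 i) * real (Stirling n2 i)))) / 2"
proof -
  define p q where "p = n1 - 1" and "q = n2 - 1"
  have n: "n1 = p + 1" "n2 = q + 1" using assms by (auto simp: p_def q_def)
  define N where "N = min p q"
  define A B :: "(nat \<times> nat) set" where "A = {0} \<times> {..<p}" and "B = {1} \<times> {..<q}"
  have part: "finite A" "finite B" "A \<subseteq> {0} \<times> UNIV" "B \<subseteq> {1} \<times> UNIV"
    by (auto simp: A_def B_def)
  have card: "card A = p" "card B = q" by (simp_all add: A_def B_def card_cartesian_product)
  have "complete_tripartite p q 1 = multipartite (insert (2, 0) (A \<union> B))"
    by (auto simp: complete_tripartite_def multipartite_def Let_def A_def B_def lessThan_Suc)
  then have count: "real (num_acyclic_orientations (complete_tripartite (n1 - 1) (n2 - 1) 1)) =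
      (\<Sum>j\<le>N. real (Suc j) * (surj_num2 j p * surj_num2 j q))"
    using ao_cone[of A B 0 1 "(2, 0)" N] part by (simp add: n card N_def)
  define t where "t i = (fact (i - 2))\<^sup>2 *
       ((2 * real i - 3) * real (Stirling (n1 + 1) i) * real (Stirling (n2 + 1) i)
        - (real i - 2) * (real (Stirling (n1 + 1) i) * real (Stirling n2 i)
                          + real (Stirling n1 i) * real (Stirling (n2 + 1) i))
        - real (Stirling n1 i) * real (Stirling n2 i))" for i
  let ?d = "\<lambda>j. surj_num1 j p * surj_num1 j q"
  have top: "?d (Suc N) = 0" by (auto simp: N_def surj_num1_gt min_def)
  have n': "m + 1 + 1 = m + 2" for m :: nat by simp
  have t: "t (j + 2) = 2 * (real (Suc j) * (surj_num2 j p * surj_num2 j q)) - (?d j - ?d (Suc j))" for j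
    unfolding t_def n n' add_diff_cancel_right' by (rule summand_eq_telescoping)
  have "sum t {2..min n1 n2 + 1} = (\<Sum>j\<le>N. t (j + 2))"
    using sum.shift_bounds_cl_nat_ivl[of t 0 2 N] by (simp add: n N_def atMost_atLeast0 numeral_2_eq_2)
  also have "\<dots> = (\<Sum>j\<le>N. 2 * (real (Suc j) * (surj_num2 j p * surj_num2 j q)) - (?d j - ?d (Suc j)))"
    by (simp only: t)
  also have "\<dots> = 2 * (\<Sum>j\<le>N. real (Suc j) * (surj_num2 j p * surj_num2 j q)) - (?d 0 - ?d (Suc N))"
    by (simp only: sum_subtractf[of _ "\<lambda>j. ?d j - ?d (Suc j)"] sum_telescope[of ?d] sum_distrib_left)
  also have "?d 0 = 1" by (simp add: surj_num1_eq del: Stirling.simps)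
  finally have "sum t {2..min n1 n2 + 1} =
      2 * real (num_acyclic_orientations (complete_tripartite (n1 - 1) (n2 - 1) 1)) - 1"
    using count top by simp
  then show ?thesis unfolding t_def by simp
qed

end
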